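(* Let $(X,\mu_x,\le)_{x\in X}$ be a partially ordered family of measure spaces satisfying conditions (1)–(4) of the context, and let $\prec$ be a second order on $X$ satisfying conditions (i)–(ii) of the context. Let $\nu$ be a measure on $X$ and let $p>0$. Then the Hardy operator $S$ is bounded $$S: L^p_{\prec}(d\nu)\longrightarrow L^p(d\nu)$$ (that is, there is a constant $C'$ with $\|Sf\|_{L^p(d\nu)}\le C'\|f\|_{L^p(d\nu)}$ for all $f\in L^p_\prec(d\nu)$) if and only if there exists a constant $C>0$ such that, for all $\prec$-decreasing sets $D\subset X$, $$\int_{X\setminus D}\mu_x(D\cap X_x)^p\,d\nu(x)\le C\,\nu(D).$$
   Context: $X$ is a set with a $\sigma$-algebra; for each $x\in X$, $\mu_x$ is a $\sigma$-finite measure on $X$; $\le$ is a partial order on $X$. A function $f$ is decreasing with respect to an order if $x$ below $y$ implies $f(x)\ge f(y)$; a set $D$ is decreasing if $\chi_D$ is a decreasing function. Put $X_x=\{u\in X: u\le x\}$. The standing assumptions are: (1) for every $x$, the restriction of $\le$ to $X_x$ is a total order; (2) every $\le$-decreasing set is measurable; (3) $\mu_x(X_x)=1$ for every $x$; (4) if $u\in X_x$, then $d\mu_x(y)=\mu_x(X_u)\,d\mu_u(y)$, i.e. $\mu_x(E)=\mu_x(X_u)\mu_u(E)$ for all measurable $E$ (in particular $\mu_x(X_u)\mu_u(X_x)=1$). The Hardy operator is $Sf(x)=\int_{X_x}f(u)\,d\mu_x(u)$, for $f\ge 0$. The second order $\prec$ on $X$ satisfies: (i) if $x\le y$ then $x\prec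 y$; (ii) if $f$ is $\prec$-decreasing, then $Sf$ is $\prec$-decreasing. The order $\le$ is always the one used to define $S$ and $X_x$. $L^p_\prec(d\nu)$ is the class of nonnegative $\prec$-decreasing functions in $L^p(d\nu)$, where $\nu$ is a measure on the $\sigma$-algebra of $X$, and $\|f\|_{L^p(d\nu)}=(\int_X|f|^p\,d\nu)^{1/p}$ for all $p>0$. General measurability assumption: only cases in which all functions involved are measurable are considered; in particular, for each $x\in X$ the set $\{(u,v)\in X_x\times X_x: u\le v\}$ is measurable with respect to the product $\sigma$-algebra (so Tonelli's theorem applies to its characteristic function). *)

theory Defs
  imports "HOL-Analysis.Analysis"
begin

text \<open>
  Orders are relations on the carrier, \<open>(x, y) \<in> r\<close> meaning that \<open>x\<close> is below \<open>y\<close>.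
\<close>

definition decreasing_fun_on :: "'a set \<Rightarrow> 'a rel \<Rightarrow> ('a \<Rightarrow> 'b::ord) \<Rightarrow> bool" where
  "decreasing_fun_on X r f \<longleftrightarrow> monotone_on X (\<lambda>x y. (x, y) \<in> r) (\<ge>) f"

definition decreasing_set_on :: "'a set \<Rightarrow> 'a rel \<Rightarrow> 'a set \<Rightarrow> bool" where
  "decreasing_set_on X r D \<longleftrightarrow> D \<subseteq> X \<and> decreasing_fun_on X r (indicator D :: 'a \<Rightarrow> real)"

definition lower_section :: "'a set \<Rightarrow> 'a rel \<Rightarrow> 'a \<Rightarrow> 'a set" where
  "lower_section X r x = {u \<in> X. (u, x) \<in> r}"

definition hardy_op :: "'a set \<Rightarrow> ('a \<Rightarrow> 'a measure) \<Rightarrow> 'a rel \<Rightarrow> ('a \<Rightarrow> real) \<Rightarrow> 'a \<Rightarrow> ennreal" where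
  "hardy_op X \<mu> r f x = (\<integral>\<^sup>+u\<in>lower_section X r x. ennreal (f u) \<partial>\<mu> x)"

text \<open>
  In the following locale only the carrier and the \<open>\<sigma>\<close>-algebra of the measure \<open>M\<close> matter,
  never its values.
\<close>

locale ordered_measure_family =
  fixes M :: "'a measure" and \<mu> :: "'a \<Rightarrow> 'a measure" and le :: "'a rel"
  assumes sets_mu: "\<And>x. x \<in> space M \<Longrightarrow> sets (\<mu> x) = sets M"
    and sigma_finite_mu: "\<And>x. x \<in> space M \<Longrightarrow> sigma_finite_measure (\<mu> x)"
    and partial_order_le: "partial_order_on (space M) le"
    and total_section: "\<And>x. x \<in> space M \<Longrightarrow>
      linear_order_on (lower_section (space M) le x) (Restr le (lower_section (space M) le x))"
    and decreasing_measurable: "\<And>D. decreasing_set_on (space M) le D \<Longrightarrow> D \<in> sets M"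
    and section_mass: "\<And>x. x \<in> space M \<Longrightarrow> emeasure (\<mu> x) (lower_section (space M) le x) = 1"
    and section_scaling: "\<And>x u E. \<lbrakk>x \<in> space M; u \<in> lower_section (space M) le x; E \<in> sets M\<rbrakk> \<Longrightarrow>
      emeasure (\<mu> x) E = emeasure (\<mu> x) (lower_section (space M) le u) * emeasure (\<mu> u) E"
    and order_measurable: "\<And>x. x \<in> space M \<Longrightarrow>
      {(u, v). u \<in> lower_section (space M) le x \<and> v \<in> lower_section (space M) le x \<and> (u, v) \<in> le}
        \<in> sets (M \<Otimes>\<^sub>M M)"

text \<open>
  No further measurability hypothesis is needed: a \<open>\<prec>\<close>-decreasing function is \<open>\<le>\<close>-decreasing, so
  its superlevel sets are measurable by condition \<open>decreasing_measurable\<close>, and the same holds for its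
  image under the Hardy operator.
\<close>

locale second_order = ordered_measure_family M \<mu> le
  for M :: "'a measure" and \<mu> :: "'a \<Rightarrow> 'a measure" and le :: "'a rel" +
  fixes prec :: "'a rel"
  assumes partial_order_prec: "partial_order_on (space M) prec"
    and le_imp_prec: "\<And>x y. \<lbrakk>x \<in> space M; y \<in> space M; (x, y) \<in> le\<rbrakk> \<Longrightarrow> (x, y) \<in> prec"
    and hardy_decreasing: "\<And>f :: 'a \<Rightarrow> real.
      \<lbrakk>\<And>x. x \<in> space M \<Longrightarrow> 0 \<le> f x; decreasing_fun_on (space M) prec f\<rbrakk> \<Longrightarrow>
      decreasing_fun_on (space M) prec (hardy_op (space M) \<mu> le f)"

text \<open>
  The power \<open>x\<^sup>p\<close> on \<open>[0, \<infinity>]\<close>, meant for exponents \<open>p > 0\<close> only, so that \<open>\<infinity>\<^sup>p = \<infinity>\<close>.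
\<close>

definition ennreal_rpow :: "ennreal \<Rightarrow> real \<Rightarrow> ennreal" where
  "ennreal_rpow x p = (if x = \<infinity> then \<infinity> else ennreal (enn2real x powr p))"

definition Lp_norm :: "'a measure \<Rightarrow> real \<Rightarrow> ('a \<Rightarrow> ennreal) \<Rightarrow> ennreal" where
  "Lp_norm \<nu> p g = ennreal_rpow (\<integral>\<^sup>+x. ennreal_rpow (g x) p \<partial>\<nu>) (1 / p)"

definition Lp_decreasing :: "'a measure \<Rightarrow> 'a rel \<Rightarrow> real \<Rightarrow> ('a \<Rightarrow> real) set" where
  "Lp_decreasing \<nu> r p =
    {f \<in> borel_measurable \<nu>. (\<forall>x\<in>space \<nu>. 0 \<le> f x) \<and> decreasing_fun_on (space \<nu>) r f
      \<and> Lp_norm \<nu> p (\<lambda>x. ennreal (f x)) < \<infinity>}"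

end

theory Submission
  imports Defs
begin

text \<open>
  A \<open>\<prec>\<close>-decreasing set \<open>D\<close> contains \<open>X\<^sub>x\<close> for every \<open>x \<in> D\<close>, so the test condition says that
  \<open>\<integral> (S \<chi>\<^sub>D)\<^sup>p d\<nu> \<le> (C + 1) \<nu>(D)\<close>. To pass to a general \<open>f\<close>, decompose it into the levels
  \<open>D\<^sub>k = {f > 2\<^sup>k}\<close>: the sum \<open>\<Sum> 2\<^sup>k \<chi>\<close> over these sets is comparable to \<open>f\<close>. For \<open>p \<le> 1\<close>
  subadditivity of the \<open>p\<close>-th power suffices.

  For \<open>p > 1\<close>, the scaling condition and the total order on \<open>X\<^sub>x\<close> give
  \<open>(Sf(x))\<^sup>p \<le> c \<integral> h(u) \<mu>\<^sub>x(X\<^sub>u)\<^bsup>p-1\<^esup> d\<mu>\<^sub>x(u)\<close> over \<open>X\<^sub>x\<close>, with \<open>h = f (Sf)\<^bsup>p-1\<^esup>\<close>. As \<open>h\<close> is again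
  \<open>\<prec>\<close>-decreasing, its level decomposition and \<open>X\<^sub>u \<subseteq> D \<inter> X\<^sub>x\<close> for \<open>u \<in> D \<inter> X\<^sub>x\<close> give
  \<open>\<integral> (Sf)\<^sup>p d\<nu> \<le> c' \<integral> f (Sf)\<^bsup>p-1\<^esup> d\<nu>\<close>, from which \<open>(Sf)\<^sup>p\<close> is absorbed on the left. The absorption
  needs \<open>\<integral> (Sf)\<^sup>p d\<nu> < \<infinity>\<close>, which holds for the truncations of \<open>f\<close> to finitely many levels;
  monotone convergence gives the general case.
\<close>

section \<open>Powers of extended nonnegative reals\<close>

lemma ennreal_rpow_ennreal [simp]: "0 \<le> x \<Longrightarrow> ennreal_rpow (ennreal x) p = ennreal (x powr p)"
  by (simp add: ennreal_rpow_def)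

lemma ennreal_rpow_top [simp]: "ennreal_rpow top p = top"
  by (simp add: ennreal_rpow_def)

lemma ennreal_rpow_0 [simp]: "ennreal_rpow 0 p = 0"
  by (simp add: ennreal_rpow_def)

lemma ennreal_rpow_1 [simp]: "ennreal_rpow 1 p = 1"
  by (simp add: ennreal_rpow_def)

lemma ennreal_rpow_mono:
  assumes "x \<le> y" "0 \<le> p"
  shows "ennreal_rpow x p \<le> ennreal_rpow y p"
proof (cases y)
  case (real r)
  with assms(1) obtain s where "x = ennreal s" "0 \<le> s" "s \<le> r"
    by (cases x) (auto simp: top_unique)
  with real assms(2) show ?thesis by (simp add: ennreal_leI powr_mono2)
qed simp

lemma ennreal_rpow_mult:
  assumes "0 < p"
  shows "ennreal_rpow (x * y) p = ennreal_rpow x p * ennreal_rpow y p"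
  by (cases x; cases y)
    (auto simp: powr_mult ennreal_mult'[symmetric] ennreal_mult_top ennreal_top_mult)

lemma ennreal_rpow_rpow:
  assumes "0 < p"
  shows "ennreal_rpow (ennreal_rpow x p) q = ennreal_rpow x (p * q)"
  by (cases x) (auto simp: powr_powr)

lemma ennreal_rpow_one [simp]: "ennreal_rpow x 1 = x"
  by (cases x) auto

lemma ennreal_rpow_le_cancel:
  assumes "0 < p" "ennreal_rpow x p \<le> ennreal_rpow y p"
  shows "x \<le> y"
  using ennreal_rpow_mono[OF assms(2), of "1 / p"] assms(1) by (simp add: ennreal_rpow_rpow)

text \<open>For \<open>p > 0\<close> the power is an order isomorphism of the extended half-line,
  with inverse the power \<open>1 / p\<close>; suprema therefore pass through it, without any
  continuity argument.\<close>

lemma ennreal_rpow_SUP: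
  assumes "0 < p"
  shows "ennreal_rpow (SUP i\<in>I. f i) p = (SUP i\<in>I. ennreal_rpow (f i) p)"
proof (rule antisym)
  let ?z = "SUP i\<in>I. ennreal_rpow (f i) p"
  have "f i \<le> ennreal_rpow ?z (1 / p)" if "i \<in> I" for i
  proof -
    have "ennreal_rpow (f i) p \<le> ?z" using that by (rule SUP_upper)
    then have "ennreal_rpow (ennreal_rpow (f i) p) (1 / p) \<le> ennreal_rpow ?z (1 / p)"
      using assms by (intro ennreal_rpow_mono) auto
    then show ?thesis using assms by (simp add: ennreal_rpow_rpow)
  qed
  then have "(SUP i\<in>I. f i) \<le> ennreal_rpow ?z (1 / p)" by (rule SUP_least)
  then have "ennreal_rpow (SUP i\<in>I. f i) p \<le> ennreal_rpow (ennreal_rpow ?z (1 / p)) p"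
    using assms by (intro ennreal_rpow_mono) auto
  then show "ennreal_rpow (SUP i\<in>I. f i) p \<le> ?z"
    using assms by (simp add: ennreal_rpow_rpow)
next
  show "(SUP i\<in>I. ennreal_rpow (f i) p) \<le> ennreal_rpow (SUP i\<in>I. f i) p"
    using assms by (intro SUP_least ennreal_rpow_mono SUP_upper) auto
qed

lemma ennreal_rpow_add_le:
  assumes "0 < p" "p \<le> 1"
  shows "ennreal_rpow (x + y) p \<le> ennreal_rpow x p + ennreal_rpow y p"
proof (cases x; cases y)
  fix a b assume x: "x = ennreal a" "0 \<le> a" and y: "y = ennreal b" "0 \<le> b"
  have "(a + b) powr p \<le> a powr p + b powr p"
  proof (cases "a + b = 0")
    case True then show ?thesis using x y by simp
  next
    case False
    then have ab: "0 < a + b" using x y by simp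
    \<comment> \<open>The exponent \<open>p - 1\<close> is not positive, so enlarging the base from
      \<open>c\<close> to \<open>a + b\<close> decreases the power. Taking \<open>c = a\<close> and
      \<open>c = b\<close> bounds the two halves of
      \<open>(a + b) * (a + b) powr (p - 1)\<close>.\<close>
    have *: "c * (a + b) powr (p - 1) \<le> c powr p" if c: "0 \<le> c" "c \<le> a + b" for c
    proof (cases "c = 0")
      case False
      then have "(a + b) powr (p - 1) \<le> c powr (p - 1)"
        using c assms by (intro powr_mono2') auto
      then have "c * (a + b) powr (p - 1) \<le> c * c powr (p - 1)"
        using c by (intro mult_left_mono) auto
      also have "c * c powr (p - 1) = c powr p" using c False by (simp add: powr_mult_base)
      finally show ?thesis .
    qed simp
    have "(a + b) powr p = a * (a + b) powr (p - 1) + b * (a + b) powr (p - 1)"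
      using ab powr_mult_base[of "a + b" "p - 1"] by (simp add: distrib_right)
    also have "\<dots> \<le> a powr p + b powr p"
      using x y by (intro add_mono *) auto
    finally show ?thesis .
  qed
  then show ?thesis using x y by (simp flip: ennreal_plus add: ennreal_leI)
qed auto

lemma ennreal_rpow_sum_le:
  assumes "0 < p" "p \<le> 1" "finite I"
  shows "ennreal_rpow (\<Sum>i\<in>I. f i) p \<le> (\<Sum>i\<in>I. ennreal_rpow (f i) p)"
  using assms(3)
  by induction (auto intro: order_trans[OF ennreal_rpow_add_le[OF assms(1,2)]] add_left_mono)

text \<open>The sum is at most the number of terms times its largest term, and the power of that
  term is one of the summands on the right.\<close>

lemma ennreal_rpow_sum_le_card:
  fixes f :: "'i \<Rightarrow> ennreal"
  assumes "0 < p" "finite I"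
  shows "ennreal_rpow (\<Sum>i\<in>I. f i) p
    \<le> ennreal (real (card I) powr p) * (\<Sum>i\<in>I. ennreal_rpow (f i) p)"
proof (cases "I = {}")
  case False
  obtain j where j: "j \<in> I" "f j = Max (f ` I)"
    using Max_in[of "f ` I"] assms(2) False by fastforce
  then have "f i \<le> f j" if "i \<in> I" for i using assms(2) that by auto
  then have "(\<Sum>i\<in>I. f i) \<le> ennreal (real (card I)) * f j"
    using sum_bounded_above[of I f "f j"] by (simp add: ennreal_of_nat_eq_real_of_nat)
  then have "ennreal_rpow (\<Sum>i\<in>I. f i) p \<le> ennreal_rpow (ennreal (real (card I)) * f j) p"
    using assms by (intro ennreal_rpow_mono) auto
  also have "\<dots> = ennreal (real (card I) powr p) * ennreal_rpow (f j) p"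
    using assms by (simp add: ennreal_rpow_mult)
  also have "ennreal_rpow (f j) p \<le> (\<Sum>i\<in>I. ennreal_rpow (f i) p)"
    using j assms by (intro member_le_sum) auto
  finally show ?thesis by (simp add: mult_left_mono)
qed simp

section \<open>Decreasing functions and sets\<close>

lemma decreasing_fun_onD:
  "decreasing_fun_on X r f \<Longrightarrow> x \<in> X \<Longrightarrow> y \<in> X \<Longrightarrow> (x, y) \<in> r \<Longrightarrow> f y \<le> f x"
  by (auto simp: decreasing_fun_on_def monotone_on_def)

lemma decreasing_fun_onI:
  "(\<And>x y. x \<in> X \<Longrightarrow> y \<in> X \<Longrightarrow> (x, y) \<in> r \<Longrightarrow> f y \<le> f x) \<Longrightarrow> decreasing_fun_on X r f"
  by (auto simp: decreasing_fun_on_def monotone_on_def)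

lemma decreasing_set_on_iff:
  "decreasing_set_on X r D \<longleftrightarrow>
    D \<subseteq> X \<and> (\<forall>x\<in>X. \<forall>y\<in>X. (x, y) \<in> r \<longrightarrow> y \<in> D \<longrightarrow> x \<in> D)"
  by (auto simp: decreasing_set_on_def decreasing_fun_on_def monotone_on_def indicator_def)

lemma decreasing_set_on_level:
  fixes f :: "'a \<Rightarrow> 'b::order"
  shows "decreasing_fun_on X r f \<Longrightarrow> decreasing_set_on X r {x \<in> X. c < f x}"
  by (auto simp: decreasing_set_on_iff dest: decreasing_fun_onD less_le_trans)

lemma decreasing_fun_on_mono_comp:
  "decreasing_fun_on X r f \<Longrightarrow> mono g \<Longrightarrow> decreasing_fun_on X r (\<lambda>x. g (f x))"
  by (auto intro!: decreasing_fun_onI dest: decreasing_fun_onD monoD)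

section \<open>Dyadic level decomposition\<close>

text \<open>Indexing the integer powers of two by the naturals makes truncations partial sums of a series.\<close>

definition dyad :: "nat \<Rightarrow> real" where
  "dyad i = 2 powr real_of_int (int_decode i)"

lemma dyad_pos [simp]: "0 < dyad i" and dyad_nonneg [simp]: "0 \<le> dyad i"
  by (simp_all add: dyad_def)

text \<open>The powers of two below \<open>t\<close> are those with exponent at most some integer
  \<open>K\<close>. Summed downwards from \<open>K\<close>, via the reindexing
  \<open>k = K - j\<close>, their \<open>q\<close>-th powers form a geometric series of ratio
  \<open>2 powr (-q)\<close>.\<close>

lemma suminf_dyad_below:
  assumes "0 < t" "0 < q"
  obtains K :: int where "2 powr K < t" "t \<le> 2 powr (K + 1)"
    "(\<Sum>i. ennreal (dyad i powr q) * indicator {..<t} (dyad i))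
       = ennreal ((2 powr K) powr q / (1 - 2 powr (-q)))"
proof -
  \<comment> \<open>Ceiling minus one rather than floor, because levels are strict: when
    \<open>t\<close> is itself a power of two, that power must be left out.\<close>
  define K where "K = \<lceil>log 2 t\<rceil> - 1"
  have K: "2 powr k < t \<longleftrightarrow> k \<le> K" for k :: int
  proof -
    have "2 powr k < t \<longleftrightarrow> real_of_int k < log 2 t" using assms by (simp add: less_log_iff)
    also have "\<dots> \<longleftrightarrow> k \<le> K" unfolding K_def by (simp add: less_ceiling_iff[symmetric])
    finally show ?thesis .
  qed
  let ?g = "\<lambda>k::int. ennreal ((2 powr k) powr q) * indicator {..<t} (2 powr k)"
  have "(\<Sum>i. ennreal (dyad i powr q) * indicator {..<t} (dyad i))
      = (\<integral>\<^sup>+i. ?g (int_decode i) \<partial>count_space UNIV)"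
    by (simp add: nn_integral_count_space_nat dyad_def)
  also have "\<dots> = (\<integral>\<^sup>+k. ?g k \<partial>count_space UNIV)"
    by (rule nn_integral_bij_count_space[OF bij_int_decode])
  also have "\<dots> = (\<integral>\<^sup>+k. ennreal ((2 powr k) powr q) * indicator {..K} k \<partial>count_space UNIV)"
    by (intro nn_integral_cong) (auto simp: K split: split_indicator)
  also have "\<dots> = (\<integral>\<^sup>+k. ennreal ((2 powr k) powr q) \<partial>count_space {..K})"
    by (simp add: nn_integral_count_space_indicator)
  also have "\<dots> = (\<integral>\<^sup>+j. ennreal ((2 powr real_of_int (K - int j)) powr q) \<partial>count_space UNIV)"
    by (rule nn_integral_bij_count_space[symmetric], rule bij_betwI[of _ _ _ "\<lambda>k. nat (K - k)"]) auto
  also have "\<dots> = (\<Sum>j. ennreal ((2 powr K) powr q * (2 powr (-q)) ^ j))"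
    by (simp add: nn_integral_count_space_nat powr_powr powr_add[symmetric] powr_realpow[symmetric]
        algebra_simps)
  also have "\<dots> = ennreal ((2 powr K) powr q / (1 - 2 powr (-q)))"
  proof (rule suminf_ennreal_eq)
    show "(\<lambda>j. (2 powr K) powr q * (2 powr (-q)) ^ j) sums ((2 powr K) powr q / (1 - 2 powr (-q)))"
      using sums_mult[OF geometric_sums[of "2 powr (-q)"], of "(2 powr K) powr q"] assms
      by (simp add: powr_minus field_simps)
  qed auto
  finally show thesis
    using K[of K] K[of "K + 1"] that[of K] by auto
qed

text \<open>For \<open>q = 1\<close> the geometric sum is \<open>2 powr (K + 1)\<close>, the first
  power of two that is not below \<open>t\<close>.\<close>

lemma le_suminf_dyad:
  assumes "0 \<le> t"
  shows "ennreal t \<le> (\<Sum>i. ennreal (dyad i) * indicator {..<t} (dyad i))"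
proof (cases "t = 0")
  case False
  with assms have "0 < t" by simp
  then obtain K :: int where "t \<le> 2 powr (K + 1)"
    "(\<Sum>i. ennreal (dyad i powr 1) * indicator {..<t} (dyad i))
       = ennreal ((2 powr K) powr 1 / (1 - 2 powr (-1)))"
    using suminf_dyad_below[of t 1] zero_less_one by blast
  then show ?thesis by (simp add: powr_minus powr_add ennreal_leI)
qed simp

text \<open>For \<open>q > 0\<close> this is the sum of the geometric series of ratio
  \<open>2 powr (-q)\<close>; it equals 2 for \<open>q = 1\<close>. It is the loss in replacing a
  function by its dyadic layers.\<close>

definition dyad_const :: "real \<Rightarrow> real" where
  "dyad_const q = 1 / (1 - 2 powr (-q))"

lemma dyad_const_pos: "0 < q \<Longrightarrow> 0 < dyad_const q"
  by (simp add: dyad_const_def powr_minus field_simps)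

lemma suminf_dyad_le:
  assumes "0 \<le> t" "0 < q"
  shows "(\<Sum>i. ennreal (dyad i powr q) * indicator {..<t} (dyad i))
    \<le> ennreal (dyad_const q * t powr q)"
proof (cases "t = 0")
  case True
  then have "\<not> dyad i < t" for i using dyad_pos[of i] by linarith
  then show ?thesis by simp
next
  case False
  with assms have "0 < t" by simp
  then obtain K :: int where K: "2 powr K < t"
    "(\<Sum>i. ennreal (dyad i powr q) * indicator {..<t} (dyad i))
       = ennreal ((2 powr K) powr q / (1 - 2 powr (-q)))"
    using assms(2) by (rule suminf_dyad_below)
  have "(2 powr K) powr q \<le> t powr q" using K assms by (intro powr_mono2) auto
  then have "dyad_const q * (2 powr K) powr q \<le> dyad_const q * t powr q"
    using dyad_const_pos[OF assms(2)] by (intro mult_left_mono) auto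
  then show ?thesis unfolding K(2) by (intro ennreal_leI) (simp add: dyad_const_def)
qed

text \<open>Keeping finitely many layers yields a bounded function, on which the Hardy operator is
  finite. For nonnegative \<open>f\<close> the supremum over \<open>n\<close> lies between
  \<open>f\<close> and \<open>dyad_const 1 * f\<close>.\<close>

definition dyad_trunc :: "('a \<Rightarrow> real) \<Rightarrow> nat \<Rightarrow> 'a \<Rightarrow> real" where
  "dyad_trunc f n x = (\<Sum>i<n. dyad i * indicator {..<f x} (dyad i))"

lemma dyad_trunc_nonneg: "0 \<le> dyad_trunc f n x"
  by (simp add: dyad_trunc_def sum_nonneg)

lemma dyad_trunc_bounded: "dyad_trunc f n x \<le> (\<Sum>i<n. dyad i)"
  unfolding dyad_trunc_def by (intro sum_mono) (simp split: split_indicator)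

lemma decreasing_dyad_trunc:
  "decreasing_fun_on X r f \<Longrightarrow> decreasing_fun_on X r (dyad_trunc f n)"
  unfolding dyad_trunc_def
  by (intro decreasing_fun_onI sum_mono) (force split: split_indicator dest: decreasing_fun_onD)

lemma ennreal_dyad_trunc:
  "ennreal (dyad_trunc f n x) = (\<Sum>i<n. ennreal (dyad i) * indicator {..<f x} (dyad i))"
  unfolding dyad_trunc_def
  by (subst sum_ennreal[symmetric]) (auto intro!: sum.cong split: split_indicator)

lemma sum_dyad_le:
  assumes "0 \<le> t" "0 < q"
  shows "(\<Sum>i<n. ennreal (dyad i powr q) * indicator {..<t} (dyad i))
    \<le> ennreal (dyad_const q * t powr q)"
  by (rule order_trans[OF sum_le_suminf suminf_dyad_le[OF assms]]) auto

lemma dyad_trunc_le: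
  assumes "0 \<le> f x"
  shows "dyad_trunc f n x \<le> dyad_const 1 * f x"
proof -
  have "ennreal (dyad_trunc f n x) \<le> ennreal (dyad_const 1 * f x)"
    using sum_dyad_le[OF assms, of 1 n] assms by (simp add: ennreal_dyad_trunc)
  then show ?thesis using assms dyad_const_pos[of 1] by (subst (asm) ennreal_le_iff) auto
qed

lemma incseq_dyad_trunc: "incseq (\<lambda>n. ennreal (dyad_trunc f n x))"
  unfolding ennreal_dyad_trunc by (intro incseq_SucI) simp

lemma le_SUP_dyad_trunc: "0 \<le> f x \<Longrightarrow> ennreal (f x) \<le> (SUP n. ennreal (dyad_trunc f n x))"
  using le_suminf_dyad[of "f x"] by (simp add: ennreal_dyad_trunc suminf_eq_SUP)

section \<open>The Hardy operator\<close>

text \<open>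
  Measurability of the order in the product is what excludes long chains, such as \<open>\<omega>\<^sub>1\<close>, on which
  every initial segment is null.
\<close>

lemma emeasure_square_le:
  assumes "finite_measure L" and A: "A \<in> sets L" and R: "R \<in> sets (L \<Otimes>\<^sub>M L)"
    and total: "\<And>u v. u \<in> A \<Longrightarrow> v \<in> A \<Longrightarrow> (u, v) \<in> R \<or> (v, u) \<in> R"
  shows "emeasure L A * emeasure L A \<le> 2 * (\<integral>\<^sup>+u\<in>A. emeasure L {v \<in> A. (v, u) \<in> R} \<partial>L)"
proof -
  interpret finite_measure L by fact
  have sf: "sigma_finite_measure L" by (rule sigma_finite_measure_axioms)
  interpret pair_sigma_finite L L by standard
  let ?Q = "R \<inter> A \<times> A"
  have Q: "?Q \<in> sets (L \<Otimes>\<^sub>M L)" using A R by auto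
  have 1: "Pair u -` ?Q = (if u \<in> A then {v \<in> A. (u, v) \<in> R} else {})" for u by auto
  have 2: "(\<lambda>v. (v, u)) -` ?Q = (if u \<in> A then {v \<in> A. (v, u) \<in> R} else {})" for u by auto
  have m: "(\<lambda>u. emeasure L (Pair u -` ?Q)) \<in> borel_measurable L"
      "(\<lambda>u. emeasure L ((\<lambda>v. (v, u)) -` ?Q)) \<in> borel_measurable L"
    using measurable_emeasure_Pair1[OF Q] measurable_emeasure_Pair2[OF Q] .
  have "emeasure L A * emeasure L A = (\<integral>\<^sup>+u. emeasure L A * indicator A u \<partial>L)"
    using A by (simp add: nn_integral_cmult_indicator)
  also have "\<dots> \<le> (\<integral>\<^sup>+u. emeasure L (Pair u -` ?Q) + emeasure L ((\<lambda>v. (v, u)) -` ?Q) \<partial>L)"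
  proof (intro nn_integral_mono)
    fix u
    show "emeasure L A * indicator A u \<le> emeasure L (Pair u -` ?Q) + emeasure L ((\<lambda>v. (v, u)) -` ?Q)"
    proof (cases "u \<in> A")
      case True
      \<comment> \<open>By totality each point of \<open>A\<close> is above or below
        \<open>u\<close>, so the two slices of \<open>?Q\<close> at \<open>u\<close> cover
        \<open>A\<close>.\<close>
      have "emeasure L A = emeasure L (Pair u -` ?Q \<union> (\<lambda>v. (v, u)) -` ?Q)"
        using total[OF True] True by (intro arg_cong[where f = "emeasure L"]) auto
      also have "\<dots> \<le> emeasure L (Pair u -` ?Q) + emeasure L ((\<lambda>v. (v, u)) -` ?Q)"
        by (intro emeasure_subadditive sets_Pair1[OF Q] sets_Pair2[OF Q])
      finally show ?thesis using True by simp
    qed simp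
  qed
  also have "\<dots> = (\<integral>\<^sup>+u. emeasure L (Pair u -` ?Q) \<partial>L) + (\<integral>\<^sup>+u. emeasure L ((\<lambda>v. (v, u)) -` ?Q) \<partial>L)"
    using m by (intro nn_integral_add)
  \<comment> \<open>By Tonelli both integrals equal the product measure of \<open>?Q\<close>, sliced
    along one coordinate or the other.\<close>
  also have "\<dots> = 2 * (\<integral>\<^sup>+u. emeasure L ((\<lambda>v. (v, u)) -` ?Q) \<partial>L)"
    by (simp only: sigma_finite_measure.emeasure_pair_measure_alt[OF sf Q, symmetric] emeasure_pair_measure_alt2[OF Q, symmetric] mult_2)
  also have "(\<integral>\<^sup>+u. emeasure L ((\<lambda>v. (v, u)) -` ?Q) \<partial>L) = (\<integral>\<^sup>+u\<in>A. emeasure L {v \<in> A. (v, u) \<in> R} \<partial>L)"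
    by (intro nn_integral_cong) (auto split: split_indicator intro!: arg_cong[where f = "emeasure L"])
  finally show ?thesis .
qed

section \<open>Pointwise estimates for the Hardy operator on one lower section\<close>

context ordered_measure_family
begin

lemma decreasing_fun_measurable:
  fixes f :: "'a \<Rightarrow> 'b::{linorder_topology, second_countable_topology}"
  assumes "decreasing_fun_on (space M) le f"
  shows "f \<in> borel_measurable M"
  by (rule borel_measurableI_greater, rule decreasing_measurable, rule decreasing_set_on_level) fact

lemma le_trans: "(x, y) \<in> le \<Longrightarrow> (y, z) \<in> le \<Longrightarrow> (x, z) \<in> le"
  using partial_order_le by (auto simp: partial_order_on_def preorder_on_def dest: transD)

lemma le_refl: "x \<in> space M \<Longrightarrow> (x, x) \<in> le"
  using partial_order_le by (auto simp: partial_order_on_def preorder_on_def dest: refl_onD)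

lemma space_mu: "x \<in> space M \<Longrightarrow> space (\<mu> x) = space M"
  using sets_mu by (rule sets_eq_imp_space_eq)

lemma lower_section_measurable: "lower_section (space M) le x \<in> sets M"
  by (rule decreasing_measurable) (auto simp: decreasing_set_on_iff lower_section_def intro: le_trans)

lemma lower_section_mono:
  "(u, v) \<in> le \<Longrightarrow> lower_section (space M) le u \<subseteq> lower_section (space M) le v"
  by (auto simp: lower_section_def intro: le_trans)

lemma lower_section_total:
  assumes "x \<in> space M" "u \<in> lower_section (space M) le x" "v \<in> lower_section (space M) le x"
  shows "(u, v) \<in> le \<or> (v, u) \<in> le"
proof (cases "u = v")
  case True
  with assms show ?thesis by (auto simp: lower_section_def intro: le_refl)
next
  case False
  with total_section[OF assms(1)] assms(2,3) show ?thesis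
    by (auto simp: linear_order_on_def total_on_def)
qed

lemma mu_eq_scale:
  assumes "x \<in> space M" "u \<in> lower_section (space M) le x"
  shows "\<mu> x = scale_measure (emeasure (\<mu> x) (lower_section (space M) le u)) (\<mu> u)"
proof (rule measure_eqI)
  have "u \<in> space M" using assms by (auto simp: lower_section_def)
  then show "sets (\<mu> x) = sets (scale_measure (emeasure (\<mu> x) (lower_section (space M) le u)) (\<mu> u))"
    using assms by (simp add: sets_mu)
  show "emeasure (\<mu> x) E = emeasure (scale_measure (emeasure (\<mu> x) (lower_section (space M) le u)) (\<mu> u)) E"
    if "E \<in> sets (\<mu> x)" for E
    using that assms section_scaling[OF assms] by (simp add: sets_mu emeasure_scale_measure)
qed

text \<open>The Hardy operator averages over a set of mass one, so it keeps upper bounds. This makes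
  it finite on bounded functions.\<close>

lemma hardy_op_le:
  assumes x: "x \<in> space M" and B: "\<And>u. u \<in> space M \<Longrightarrow> f u \<le> B"
  shows "hardy_op (space M) \<mu> le f x \<le> ennreal B"
proof -
  have "hardy_op (space M) \<mu> le f x \<le> (\<integral>\<^sup>+u. ennreal B * indicator (lower_section (space M) le x) u \<partial>\<mu> x)"
    unfolding hardy_op_def
    by (intro nn_integral_mono) (auto simp: space_mu[OF x] split: split_indicator intro!: ennreal_leI B)
  also have "\<dots> = ennreal B"
    using x by (simp add: nn_integral_cmult_indicator sets_mu lower_section_measurable section_mass)
  finally show ?thesis .
qed

text \<open>Let \<open>L\<close> have density \<open>ennreal (f u)\<close> with respect to
  \<open>\<mu> x\<close> on \<open>X_x\<close>, so that its mass is \<open>t = Sf(x)\<close>. The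
  scaling condition gives \<open>L(X_u) = \<mu>_x(X_u) Sf(u)\<close>, so the right-hand integral is
  that of \<open>L(X_u)^(p-1)\<close> against \<open>L\<close>, an analogue of the integral of
  \<open>s^(p-1)\<close> over \<open>[0, t]\<close>. It suffices that at least half of the mass sits
  where \<open>L(X_u) \<ge> t/4\<close>.\<close>

lemma hardy_op_power_le:
  assumes x: "x \<in> space M" and f: "f \<in> borel_measurable M"
    and B: "\<And>u. u \<in> space M \<Longrightarrow> f u \<le> B" and p: "1 < p"
  shows "ennreal_rpow (hardy_op (space M) \<mu> le f x) p \<le> ennreal (2 * 4 powr (p - 1)) *
    (\<integral>\<^sup>+u\<in>lower_section (space M) le x. ennreal (f u) * ennreal_rpow (hardy_op (space M) \<mu> le f u) (p - 1)
        * ennreal_rpow (emeasure (\<mu> x) (lower_section (space M) le u)) (p - 1) \<partial>\<mu> x)"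
proof -
  let ?S = "hardy_op (space M) \<mu> le f"
  let ?X = "\<lambda>u. lower_section (space M) le u"
  define L where "L = density (\<mu> x) (\<lambda>u. ennreal (f u) * indicator (?X x) u)"
  note [measurable] = f lower_section_measurable
  note [simp] = sets_mu[OF x] space_mu[OF x]
  note [measurable_cong] = sets_mu[OF x]
  have setsL [simp]: "sets L = sets M" and spaceL [simp]: "space L = space M"
    by (simp_all add: L_def)
  have L: "emeasure L E = (\<integral>\<^sup>+u. ennreal (f u) * indicator (?X x) u * indicator E u \<partial>\<mu> x)"
    if "E \<in> sets M" for E
    unfolding L_def using that by (subst emeasure_density) auto
  have L_sec: "emeasure L (?X u) = emeasure (\<mu> x) (?X u) * ?S u" if u: "u \<in> ?X x" for u
  proof -
    have uM: "u \<in> space M" using u by (auto simp: lower_section_def)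
    have *: "?X u \<subseteq> ?X x" using u by (intro lower_section_mono) (auto simp: lower_section_def)
    have "emeasure L (?X u) = (\<integral>\<^sup>+v. ennreal (f v) * indicator (?X u) v \<partial>\<mu> x)"
      unfolding L[OF lower_section_measurable] using *
      by (intro nn_integral_cong) (auto split: split_indicator)
    also have "\<dots> = emeasure (\<mu> x) (?X u) * ?S u"
      unfolding hardy_op_def
      by (subst mu_eq_scale[OF x u], subst nn_integral_scale_measure)
        (simp_all add: sets_mu[OF uM] measurable_cong_sets[OF sets_mu[OF uM] refl])
    finally show ?thesis .
  qed
  have T: "emeasure L (?X x) = ?S x" "emeasure L (space M) = ?S x"
    by (auto simp: L lower_section_measurable hardy_op_def intro!: nn_integral_cong split: split_indicator)
  have "?S x < top" using hardy_op_le[of x f B, OF x B] by (auto intro: le_less_trans)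
  then obtain t where t: "?S x = ennreal t" "0 \<le> t" by (cases "?S x") auto
  interpret finite_measure L by standard (simp add: T t)
  \<comment> \<open>\<open>L\<close> gives \<open>A\<close> at most half of its mass \<open>t\<close>, and \<open>L(X\<^sub>u) \<ge> t / 4\<close> off \<open>A\<close>.\<close>
  define A where "A = {u \<in> ?X x. emeasure L (?X u) < ennreal (t / 4)}"
  have A: "A \<in> sets M"
  proof (rule decreasing_measurable, unfold decreasing_set_on_iff, safe)
    fix u v assume uv: "u \<in> space M" "v \<in> space M" "(u, v) \<in> le" and "v \<in> A"
    have "emeasure L (?X u) \<le> emeasure L (?X v)"
      by (intro emeasure_mono lower_section_mono uv) (simp add: lower_section_measurable)
    with \<open>v \<in> A\<close> uv show "u \<in> A" by (auto simp: A_def lower_section_def intro: le_trans)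
  qed (auto simp: A_def lower_section_def)
  let ?R = "{(u, v). u \<in> ?X x \<and> v \<in> ?X x \<and> (u, v) \<in> le}"
  have "sets (L \<Otimes>\<^sub>M L) = sets (M \<Otimes>\<^sub>M M)" by (intro sets_pair_measure_cong) simp_all
  then have R: "?R \<in> sets (L \<Otimes>\<^sub>M L)" using order_measurable[OF x] by simp
  \<comment> \<open>For \<open>u\<close> in \<open>A\<close>, the points of \<open>A\<close> below
    \<open>u\<close> lie in \<open>X_u\<close>, whose mass is less than \<open>t/4\<close>. The
    square estimate becomes \<open>L(A)^2 \<le> 2 (t/4) L(A)\<close>, whence
    \<open>L(A) \<le> t/2\<close>.\<close>
  have 1: "emeasure L A * emeasure L A \<le> 2 * (\<integral>\<^sup>+u\<in>A. emeasure L {v \<in> A. (v, u) \<in> ?R} \<partial>L)"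
    using A R finite_measure_axioms lower_section_total[OF x]
    by (intro emeasure_square_le) (auto simp: A_def)
  have "(\<integral>\<^sup>+u\<in>A. emeasure L {v \<in> A. (v, u) \<in> ?R} \<partial>L) \<le> (\<integral>\<^sup>+u. ennreal (t / 4) * indicator A u \<partial>L)"
  proof (intro nn_integral_mono)
    fix u
    have "emeasure L {v \<in> A. (v, u) \<in> ?R} \<le> emeasure L (?X u)"
      by (intro emeasure_mono) (auto simp: lower_section_measurable, auto simp: lower_section_def)
    then show "emeasure L {v \<in> A. (v, u) \<in> ?R} * indicator A u \<le> ennreal (t / 4) * indicator A u"
      by (auto simp: A_def split: split_indicator)
  qed
  also have "(\<integral>\<^sup>+u. ennreal (t / 4) * indicator A u \<partial>L) = ennreal (t / 4) * emeasure L A"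
    using A by (simp add: nn_integral_cmult_indicator)
  finally have "emeasure L A * emeasure L A \<le> 2 * (ennreal (t / 4) * emeasure L A)"
    by (intro order_trans[OF 1] mult_left_mono) simp_all
  then have "ennreal (measure L A * measure L A) \<le> ennreal (2 * (t / 4 * measure L A))"
    using t by (simp only: emeasure_eq_measure ennreal_mult measure_nonneg divide_nonneg_nonneg
        mult_nonneg_nonneg zero_le_numeral ennreal_numeral)
  then have "measure L A * measure L A \<le> (t / 2) * measure L A"
    using t by (subst (asm) ennreal_le_iff) auto
  then have LA: "measure L A \<le> t / 2"
    using t mult_le_cancel_right[of "measure L A" "measure L A" "t / 2"]
    by (cases "measure L A = 0") (simp_all add: less_le)
  have "measure L (?X x - A) = measure L (?X x) - measure L A"
    using A by (intro finite_measure_Diff) (auto simp: A_def lower_section_measurable)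
  moreover have "measure L (?X x) = t" using T(1) t by (simp add: measure_def)
  ultimately have "t / 2 \<le> measure L (?X x - A)" using LA by simp
  then have LB: "ennreal (t / 2) \<le> emeasure L (?X x - A)"
    by (simp add: emeasure_eq_measure ennreal_leI)
  \<comment> \<open>Off \<open>A\<close> the factor \<open>L(X_u)^(p-1)\<close> is at least
    \<open>(t/4)^(p-1)\<close>, and this region has mass at least \<open>t/2\<close>. The product is
    \<open>t^p\<close> divided by \<open>2 * 4^(p-1)\<close>, which is where the constant comes
    from.\<close>
  have "ennreal ((t / 4) powr (p - 1)) * ennreal (t / 2) \<le> ennreal ((t / 4) powr (p - 1)) * emeasure L (?X x - A)"
    by (intro mult_left_mono LB) simp
  also have "\<dots> = (\<integral>\<^sup>+u. ennreal ((t / 4) powr (p - 1)) * (ennreal (f u) * indicator (?X x) u * indicator (?X x - A) u) \<partial>\<mu> x)"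
    using A by (subst L) (auto simp: nn_integral_cmult)
  also have "\<dots> \<le> (\<integral>\<^sup>+u\<in>?X x. ennreal (f u) * ennreal_rpow (?S u) (p - 1)
        * ennreal_rpow (emeasure (\<mu> x) (?X u)) (p - 1) \<partial>\<mu> x)"
  proof (intro nn_integral_mono)
    fix u
    have *: "ennreal ((t / 4) powr (p - 1)) \<le> ennreal_rpow (?S u) (p - 1) * ennreal_rpow (emeasure (\<mu> x) (?X u)) (p - 1)"
      if u: "u \<in> ?X x" "u \<notin> A"
    proof -
      have "ennreal (t / 4) \<le> emeasure (\<mu> x) (?X u) * ?S u"
        using u L_sec[OF u(1)] by (auto simp: A_def)
      then have "ennreal_rpow (ennreal (t / 4)) (p - 1) \<le> ennreal_rpow (emeasure (\<mu> x) (?X u) * ?S u) (p - 1)"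
        using p by (intro ennreal_rpow_mono) auto
      then show ?thesis using p t by (simp add: ennreal_rpow_mult mult.commute)
    qed
    show "ennreal ((t / 4) powr (p - 1)) * (ennreal (f u) * indicator (?X x) u * indicator (?X x - A) u)
      \<le> ennreal (f u) * ennreal_rpow (?S u) (p - 1)
        * ennreal_rpow (emeasure (\<mu> x) (?X u)) (p - 1) * indicator (?X x) u"
    proof (cases "u \<in> ?X x \<and> u \<notin> A")
      case True
      then have "ennreal (f u) * ennreal ((t / 4) powr (p - 1))
          \<le> ennreal (f u) * (ennreal_rpow (?S u) (p - 1) * ennreal_rpow (emeasure (\<mu> x) (?X u)) (p - 1))"
        using * by (intro mult_left_mono) simp_all
      then show ?thesis using True by (simp add: mult_ac)
    qed (auto split: split_indicator)
  qed
  finally have "ennreal (2 * 4 powr (p - 1)) * (ennreal ((t / 4) powr (p - 1)) * ennreal (t / 2))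
     \<le> ennreal (2 * 4 powr (p - 1)) * (\<integral>\<^sup>+u\<in>?X x. ennreal (f u) * ennreal_rpow (?S u) (p - 1)
        * ennreal_rpow (emeasure (\<mu> x) (?X u)) (p - 1) \<partial>\<mu> x)"
    by (intro mult_left_mono) simp_all
  moreover have "ennreal (2 * 4 powr (p - 1)) * (ennreal ((t / 4) powr (p - 1)) * ennreal (t / 2)) = ennreal (t powr p)"
  proof -
    have "4 powr (p - 1) * (t / 4) powr (p - 1) = t powr (p - 1)"
      using t by (subst powr_mult[symmetric]) simp_all
    then have "2 * 4 powr (p - 1) * ((t / 4) powr (p - 1) * (t / 2)) = t * t powr (p - 1)"
      by (simp add: mult_ac)
    also have "\<dots> = t powr p"
      using t by (subst powr_mult_base) simp_all
    finally show ?thesis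
      using t by (subst ennreal_mult[symmetric], simp, simp, subst ennreal_mult[symmetric]) simp_all
  qed
  ultimately show ?thesis unfolding t(1) ennreal_rpow_ennreal[OF t(2)] by (simp only:)
qed

end

lemma (in ordered_measure_family) hardy_op_indicator:
  assumes "x \<in> space M" "D \<in> sets M"
  shows "hardy_op (space M) \<mu> le (indicator D) x = emeasure (\<mu> x) (D \<inter> lower_section (space M) le x)"
proof -
  have "hardy_op (space M) \<mu> le (indicator D) x
      = (\<integral>\<^sup>+u. indicator (D \<inter> lower_section (space M) le x) u \<partial>\<mu> x)"
    unfolding hardy_op_def by (intro nn_integral_cong) (auto split: split_indicator)
  moreover have "D \<inter> lower_section (space M) le x \<in> sets (\<mu> x)"
    using assms by (simp add: sets_mu lower_section_measurable sets.Int)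
  ultimately show ?thesis by simp
qed

section \<open>The Hardy operator and the levels of \<prec>-decreasing functions\<close>

context second_order
begin

abbreviation "S \<equiv> hardy_op (space M) \<mu> le"
abbreviation "level f i \<equiv> {x \<in> space M. dyad i < f x}"
abbreviation "mass D x \<equiv> emeasure (\<mu> x) (D \<inter> lower_section (space M) le x)"

lemma prec_decreasing_fun: "decreasing_fun_on (space M) prec f \<Longrightarrow> decreasing_fun_on (space M) le f"
  by (auto intro!: decreasing_fun_onI dest: decreasing_fun_onD le_imp_prec)

lemma prec_decreasing_set: "decreasing_set_on (space M) prec D \<Longrightarrow> D \<in> sets M"
  by (intro decreasing_measurable) (auto simp: decreasing_set_on_def prec_decreasing_fun)

lemma prec_measurable:
  fixes f :: "'a \<Rightarrow> 'b::{linorder_topology, second_countable_topology}"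
  shows "decreasing_fun_on (space M) prec f \<Longrightarrow> f \<in> borel_measurable M"
  by (intro decreasing_fun_measurable prec_decreasing_fun)

text \<open>The mass is the Hardy operator applied to the indicator of \<open>D\<close>, so
  condition (ii) applies. Its measurability in \<open>x\<close>, not evident since the measure
  \<open>\<mu> x\<close> varies with the point, follows from this monotonicity.\<close>

lemma decreasing_mass:
  assumes "decreasing_set_on (space M) prec D"
  shows "decreasing_fun_on (space M) prec (mass D)"
proof -
  have "decreasing_fun_on (space M) prec (S (indicator D))"
    using assms by (intro hardy_decreasing) (auto simp: decreasing_set_on_def)
  then show ?thesis using hardy_op_indicator[OF _ prec_decreasing_set[OF assms]]
    by (auto simp: decreasing_fun_on_def monotone_on_def)
qed

lemma mass_rpow_measurable:
  assumes "decreasing_set_on (space M) prec D" "0 \<le> q"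
  shows "(\<lambda>x. ennreal_rpow (mass D x) q) \<in> borel_measurable M"
  using assms
  by (intro prec_measurable decreasing_fun_on_mono_comp[OF decreasing_mass] monoI ennreal_rpow_mono)

lemma hardy_op_dyad_trunc:
  assumes x: "x \<in> space M" and f: "decreasing_fun_on (space M) prec f"
  shows "S (dyad_trunc f n) x = (\<Sum>i<n. ennreal (dyad i) * mass (level f i) x)"
proof -
  let ?X = "lower_section (space M) le x"
  have m: "level f i \<inter> ?X \<in> sets (\<mu> x)" for i
    using x prec_decreasing_set[OF decreasing_set_on_level[OF f]] lower_section_measurable
    by (simp add: sets_mu)
  have "S (dyad_trunc f n) x = (\<integral>\<^sup>+u. (\<Sum>i<n. ennreal (dyad i) * indicator (level f i \<inter> ?X) u) \<partial>\<mu> x)"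
    unfolding hardy_op_def ennreal_dyad_trunc sum_distrib_right
    by (intro nn_integral_cong sum.cong refl)
      (auto simp: space_mu[OF x] split: split_indicator)
  also have "\<dots> = (\<Sum>i<n. \<integral>\<^sup>+u. ennreal (dyad i) * indicator (level f i \<inter> ?X) u \<partial>\<mu> x)"
    using m by (intro nn_integral_sum) auto
  also have "\<dots> = (\<Sum>i<n. ennreal (dyad i) * mass (level f i) x)"
    using m by (simp add: nn_integral_cmult_indicator)
  finally show ?thesis .
qed

lemma hardy_op_le_SUP:
  assumes x: "x \<in> space M" and f: "decreasing_fun_on (space M) prec f" "\<And>x. x \<in> space M \<Longrightarrow> 0 \<le> f x"
  shows "S f x \<le> (SUP n. S (dyad_trunc f n) x)"
proof -
  let ?X = "lower_section (space M) le x"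
  have "S f x \<le> (\<integral>\<^sup>+u. (SUP n. ennreal (dyad_trunc f n u) * indicator ?X u) \<partial>\<mu> x)"
    unfolding hardy_op_def
    using le_SUP_dyad_trunc[of f, OF f(2)]
    by (intro nn_integral_mono) (auto simp: space_mu[OF x] split: split_indicator)
  also have "\<dots> = (SUP n. S (dyad_trunc f n) x)"
    unfolding hardy_op_def
  proof (rule nn_integral_monotone_convergence_SUP)
    show "incseq (\<lambda>n u. ennreal (dyad_trunc f n u) * indicator ?X u)"
      using incseq_dyad_trunc[of f] by (auto simp: incseq_def le_fun_def intro!: mult_right_mono)
    show "(\<lambda>u. ennreal (dyad_trunc f n u) * indicator ?X u) \<in> borel_measurable (\<mu> x)" for n
      using prec_measurable[OF decreasing_dyad_trunc[OF f(1)], of n] lower_section_measurable[of x]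
      by (simp add: measurable_cong_sets[OF sets_mu[OF x] refl])
  qed
  finally show ?thesis .
qed

lemma hardy_op_mono:
  assumes "\<And>u. u \<in> space M \<Longrightarrow> f u \<le> g u" "x \<in> space M"
  shows "S f x \<le> S g x"
  unfolding hardy_op_def using assms
  by (intro nn_integral_mono mult_right_mono ennreal_leI) (auto simp: space_mu)

text \<open>Bound \<open>h\<close> by the sum of its dyadic layers. If \<open>u\<close> lies in a
  level of \<open>h\<close>, so does all of \<open>X_u\<close>, because \<open>h\<close> is
  decreasing; hence on that level the weight is at most the mass of the level to the power
  \<open>p - 1\<close>. Integrating the indicator of the level supplies the missing factor.\<close>

lemma layered_power_le:
  assumes x: "x \<in> space M" and h: "decreasing_fun_on (space M) prec h"
      "\<And>u. u \<in> space M \<Longrightarrow> 0 \<le> h u" and p: "1 < p"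
  shows "(\<integral>\<^sup>+u\<in>lower_section (space M) le x. ennreal (h u)
        * ennreal_rpow (emeasure (\<mu> x) (lower_section (space M) le u)) (p - 1) \<partial>\<mu> x)
    \<le> (\<Sum>i. ennreal (dyad i) * ennreal_rpow (mass (level h i) x) p)"
proof -
  let ?X = "\<lambda>u. lower_section (space M) le u"
  define m where "m i = mass (level h i) x" for i
  have meas: "level h i \<inter> ?X x \<in> sets (\<mu> x)" for i
    using x prec_decreasing_set[OF decreasing_set_on_level[OF h(1)]] lower_section_measurable
    by (simp add: sets_mu)
  have "(\<integral>\<^sup>+u\<in>?X x. ennreal (h u) * ennreal_rpow (emeasure (\<mu> x) (?X u)) (p - 1) \<partial>\<mu> x)
    \<le> (\<integral>\<^sup>+u. (\<Sum>i. ennreal (dyad i) * ennreal_rpow (m i) (p - 1) * indicator (level h i \<inter> ?X x) u) \<partial>\<mu> x)"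
  proof (intro nn_integral_mono)
    fix u assume "u \<in> space (\<mu> x)"
    then have uM: "u \<in> space M" using x by (simp add: space_mu)
    show "ennreal (h u) * ennreal_rpow (emeasure (\<mu> x) (?X u)) (p - 1) * indicator (?X x) u
      \<le> (\<Sum>i. ennreal (dyad i) * ennreal_rpow (m i) (p - 1) * indicator (level h i \<inter> ?X x) u)"
    proof (cases "u \<in> ?X x")
      case True
      have *: "ennreal_rpow (emeasure (\<mu> x) (?X u)) (p - 1) \<le> ennreal_rpow (m i) (p - 1)" if "dyad i < h u" for i
      proof (rule ennreal_rpow_mono)
        have "?X u \<subseteq> level h i \<inter> ?X x"
        proof
          fix v assume v: "v \<in> ?X u"
          then have "h u \<le> h v"
            using uM decreasing_fun_onD[OF h(1), of v u] le_imp_prec[of v u]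
            by (auto simp: lower_section_def)
          with v that True show "v \<in> level h i \<inter> ?X x"
            by (auto simp: lower_section_def intro: le_trans)
        qed
        then show "emeasure (\<mu> x) (?X u) \<le> m i"
          unfolding m_def by (intro emeasure_mono meas)
      qed (use p in simp)
      have "ennreal (h u) * ennreal_rpow (emeasure (\<mu> x) (?X u)) (p - 1)
          \<le> (\<Sum>i. ennreal (dyad i) * indicator {..<h u} (dyad i)) * ennreal_rpow (emeasure (\<mu> x) (?X u)) (p - 1)"
        by (intro mult_right_mono le_suminf_dyad h uM) simp
      also have "\<dots> = (\<Sum>i. ennreal (dyad i) * indicator {..<h u} (dyad i) * ennreal_rpow (emeasure (\<mu> x) (?X u)) (p - 1))"
        by simp
      also have "\<dots> \<le> (\<Sum>i. ennreal (dyad i) * ennreal_rpow (m i) (p - 1) * indicator (level h i \<inter> ?X x) u)"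
        using True uM * by (intro suminf_le) (auto split: split_indicator intro!: mult_left_mono)
      finally show ?thesis using True by simp
    qed simp
  qed
  also have "\<dots> = (\<Sum>i. ennreal (dyad i) * ennreal_rpow (m i) (p - 1) * m i)"
    using meas by (subst nn_integral_suminf) (auto simp: nn_integral_cmult_indicator m_def)
  also have "\<dots> = (\<Sum>i. ennreal (dyad i) * ennreal_rpow (m i) p)"
  proof -
    have "ennreal_rpow y (p - 1) * y = ennreal_rpow y p" for y
      using p powr_mult_base[of "enn2real y" "p - 1"]
      by (cases y) (auto simp: ennreal_top_mult mult.commute simp flip: ennreal_mult)
    then show ?thesis by (simp add: mult.assoc)
  qed
  finally show ?thesis unfolding m_def .
qed

end

text \<open>A form of Young's inequality by comparing \<open>b\<close> with
  \<open>2 * K * a\<close>: if \<open>b\<close> is larger, the left side is at most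
  \<open>b powr p / 2\<close>; otherwise replacing \<open>b\<close> by \<open>2 * K * a\<close>
  gives the other term. The coefficient one half on \<open>b powr p\<close> is what permits
  absorption.\<close>

lemma young_absorb:
  fixes a b K p :: real
  assumes "0 \<le> a" "0 \<le> b" "0 < K" "1 < p"
  shows "K * (a * b powr (p - 1)) \<le> b powr p / 2 + (2 * K) powr p * a powr p / 2"
proof (cases "2 * K * a \<le> b")
  case True
  then have "2 * K * a * b powr (p - 1) \<le> b * b powr (p - 1)" by (intro mult_right_mono) auto
  also have "\<dots> = b powr p" using assms by (simp add: powr_mult_base)
  finally have "K * (a * b powr (p - 1)) \<le> b powr p / 2" by simp
  also have "\<dots> \<le> b powr p / 2 + (2 * K) powr p * a powr p / 2" by simp
  finally show ?thesis .
next
  case False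
  then have "2 * K * a * b powr (p - 1) \<le> 2 * K * a * (2 * K * a) powr (p - 1)"
    using assms by (intro mult_left_mono powr_mono2) auto
  also have "\<dots> = (2 * K * a) powr p" using assms by (subst powr_mult_base) auto
  also have "\<dots> = (2 * K) powr p * a powr p" using assms by (subst powr_mult) auto
  finally have "K * (a * b powr (p - 1)) \<le> (2 * K) powr p * a powr p / 2" by simp
  also have "\<dots> \<le> b powr p / 2 + (2 * K) powr p * a powr p / 2" by simp
  finally show ?thesis .
qed

section \<open>Boundedness from the test condition\<close>

context second_order
begin

context
  fixes \<nu> :: "'a measure" and p K :: real
  assumes sets_nu: "sets \<nu> = sets M" and p: "0 < p" and K: "0 < K"
    and mass_bound: "\<And>D. decreasing_set_on (space M) prec D \<Longrightarrow>
      (\<integral>\<^sup>+x. ennreal_rpow (mass D x) p \<partial>\<nu>) \<le> ennreal K * emeasure \<nu> D"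
begin

lemma space_nu: "space \<nu> = space M"
  using sets_nu by (rule sets_eq_imp_space_eq)

lemma nu_measurable:
  fixes f :: "'a \<Rightarrow> 'b::{linorder_topology, second_countable_topology}"
  shows "decreasing_fun_on (space M) prec f \<Longrightarrow> f \<in> borel_measurable \<nu>"
  using prec_measurable by (simp add: measurable_cong_sets[OF sets_nu refl])

lemma mass_rpow_measurable_nu:
  "decreasing_set_on (space M) prec D \<Longrightarrow> (\<lambda>x. ennreal_rpow (mass D x) p) \<in> borel_measurable \<nu>"
  using mass_rpow_measurable p by (simp add: measurable_cong_sets[OF sets_nu refl])

text \<open>The assumed bound is applied to each level separately; the weighted sum of the measures
  of the levels is then compared with the integral of \<open>f powr q\<close>. The exponent
  \<open>q\<close> is independent of \<open>p\<close>: it is taken as \<open>p\<close> for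
  \<open>f\<close> itself, and as 1 for the product \<open>f (Sf)^(p-1)\<close>.\<close>

lemma suminf_mass_bound:
  assumes f: "decreasing_fun_on (space M) prec f" "\<And>x. x \<in> space M \<Longrightarrow> 0 \<le> f x" and q: "0 < q"
  shows "(\<integral>\<^sup>+x. (\<Sum>i. ennreal (dyad i powr q) * ennreal_rpow (mass (level f i) x) p) \<partial>\<nu>)
    \<le> ennreal (K * dyad_const q) * (\<integral>\<^sup>+x. ennreal (f x powr q) \<partial>\<nu>)"
proof -
  note lev = decreasing_set_on_level[OF f(1)]
  have meas: "level f i \<in> sets \<nu>" for i
    using prec_decreasing_set[OF lev] by (simp add: sets_nu)
  have fm: "(\<lambda>x. ennreal (f x powr q)) \<in> borel_measurable \<nu>"
    using nu_measurable[OF f(1)] by measurable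
  have "(\<integral>\<^sup>+x. (\<Sum>i. ennreal (dyad i powr q) * ennreal_rpow (mass (level f i) x) p) \<partial>\<nu>)
      = (\<Sum>i. ennreal (dyad i powr q) * (\<integral>\<^sup>+x. ennreal_rpow (mass (level f i) x) p \<partial>\<nu>))"
    using mass_rpow_measurable_nu[OF lev]
    by (subst nn_integral_suminf) (simp_all add: nn_integral_cmult)
  also have "\<dots> \<le> (\<Sum>i. ennreal K * (ennreal (dyad i powr q) * emeasure \<nu> (level f i)))"
    by (intro suminf_le) (subst mult.left_commute, auto intro!: mult_left_mono mass_bound lev)
  also have "\<dots> = ennreal K * (\<Sum>i. ennreal (dyad i powr q) * emeasure \<nu> (level f i))"
    by simp
  also have "(\<Sum>i. ennreal (dyad i powr q) * emeasure \<nu> (level f i))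
      = (\<integral>\<^sup>+x. (\<Sum>i. ennreal (dyad i powr q) * indicator (level f i) x) \<partial>\<nu>)"
    using meas by (subst nn_integral_suminf) (auto simp: nn_integral_cmult_indicator)
  also have "\<dots> \<le> (\<integral>\<^sup>+x. ennreal (dyad_const q) * ennreal (f x powr q) \<partial>\<nu>)"
  proof (intro nn_integral_mono)
    fix x assume "x \<in> space \<nu>"
    then have x: "x \<in> space M" by (simp add: space_nu)
    have "(\<Sum>i. ennreal (dyad i powr q) * indicator (level f i) x)
        = (\<Sum>i. ennreal (dyad i powr q) * indicator {..<f x} (dyad i))"
      using x by (intro suminf_cong) (simp split: split_indicator)
    also have "\<dots> \<le> ennreal (dyad_const q) * ennreal (f x powr q)"
      using suminf_dyad_le[OF f(2)[OF x] q] dyad_const_pos[OF q] by (simp add: ennreal_mult)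
    finally show "(\<Sum>i. ennreal (dyad i powr q) * indicator (level f i) x)
      \<le> ennreal (dyad_const q) * ennreal (f x powr q)" .
  qed
  also have "\<dots> = ennreal (dyad_const q) * (\<integral>\<^sup>+x. ennreal (f x powr q) \<partial>\<nu>)"
    using fm by (rule nn_integral_cmult)
  finally show ?thesis
    using K dyad_const_pos[OF q] by (simp add: ennreal_mult mult.assoc mult_left_mono)
qed

text \<open>
  Used with \<open>C = 1\<close> for \<open>p \<le> 1\<close>, and with \<open>C = n\<^sup>p\<close> for \<open>p > 1\<close>, where only the resulting
  finiteness matters.
\<close>

lemma hardy_trunc_le_of_sum_bound:
  assumes f: "decreasing_fun_on (space M) prec f" "\<And>x. x \<in> space M \<Longrightarrow> 0 \<le> f x"
    and C: "\<And>g :: nat \<Rightarrow> ennreal. ennreal_rpow (\<Sum>i<n. g i) p \<le> ennreal C * (\<Sum>i<n. ennreal_rpow (g i) p)"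
    and "0 \<le> C"
  shows "(\<integral>\<^sup>+x. ennreal_rpow (S (dyad_trunc f n) x) p \<partial>\<nu>)
    \<le> ennreal (C * (K * dyad_const p)) * (\<integral>\<^sup>+x. ennreal (f x powr p) \<partial>\<nu>)"
proof -
  note lev = decreasing_set_on_level[OF f(1)]
  have "(\<integral>\<^sup>+x. ennreal_rpow (S (dyad_trunc f n) x) p \<partial>\<nu>)
      \<le> (\<integral>\<^sup>+x. ennreal C * (\<Sum>i. ennreal (dyad i powr p) * ennreal_rpow (mass (level f i) x) p) \<partial>\<nu>)"
  proof (intro nn_integral_mono)
    fix x assume "x \<in> space \<nu>"
    then have x: "x \<in> space M" by (simp add: space_nu)
    have "ennreal_rpow (S (dyad_trunc f n) x) p
        \<le> ennreal C * (\<Sum>i<n. ennreal (dyad i powr p) * ennreal_rpow (mass (level f i) x) p)"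
      unfolding hardy_op_dyad_trunc[OF x f(1)]
      using C[of "\<lambda>i. ennreal (dyad i) * mass (level f i) x"] p by (simp add: ennreal_rpow_mult)
    also have "\<dots> \<le> ennreal C * (\<Sum>i. ennreal (dyad i powr p) * ennreal_rpow (mass (level f i) x) p)"
      by (intro mult_left_mono sum_le_suminf) auto
    finally show "ennreal_rpow (S (dyad_trunc f n) x) p
      \<le> ennreal C * (\<Sum>i. ennreal (dyad i powr p) * ennreal_rpow (mass (level f i) x) p)" .
  qed
  also have "\<dots> = ennreal C * (\<integral>\<^sup>+x. (\<Sum>i. ennreal (dyad i powr p) * ennreal_rpow (mass (level f i) x) p) \<partial>\<nu>)"
    using mass_rpow_measurable_nu[OF lev] by (intro nn_integral_cmult) measurable
  also have "\<dots> \<le> ennreal C * (ennreal (K * dyad_const p) * (\<integral>\<^sup>+x. ennreal (f x powr p) \<partial>\<nu>))"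
    using suminf_mass_bound[OF f p] by (intro mult_left_mono) simp_all
  finally show ?thesis using \<open>0 \<le> C\<close> K dyad_const_pos[OF p] by (simp add: ennreal_mult mult.assoc)
qed

text \<open>For \<open>p > 1\<close> the inner factor
  \<open>2 * 4 powr (p - 1) * (K * dyad_const 1)\<close> combines the constants of
  \<open>hardy_op_power_le\<close> and \<open>suminf_mass_bound\<close>; the outer shape comes from
  \<open>young_absorb\<close> and from bounding the truncation by \<open>dyad_const 1 * f\<close>.
  The number of layers does not enter, so the bound survives the limit.\<close>

definition "trunc_const =
  (if p \<le> 1 then K * dyad_const p
   else (2 * (2 * 4 powr (p - 1) * (K * dyad_const 1)) * dyad_const 1) powr p)"

lemma hardy_trunc_bounded:
  assumes f: "decreasing_fun_on (space M) prec f" "\<And>x. x \<in> space M \<Longrightarrow> 0 \<le> f x"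
    and fin: "(\<integral>\<^sup>+x. ennreal (f x powr p) \<partial>\<nu>) < \<infinity>"
  shows "(\<integral>\<^sup>+x. ennreal_rpow (S (dyad_trunc f n) x) p \<partial>\<nu>)
    \<le> ennreal trunc_const * (\<integral>\<^sup>+x. ennreal (f x powr p) \<partial>\<nu>)"
proof (cases "p \<le> 1")
  case True
  then show ?thesis
    using hardy_trunc_le_of_sum_bound[OF f, of n 1] ennreal_rpow_sum_le[OF p True, of "{..<n}"]
    by (simp add: trunc_const_def)
next
  case False
  then have p1: "1 < p" by simp
  define g where "g = dyad_trunc f n"
  \<comment> \<open>The level decomposition requires a real-valued function. Since \<open>g\<close>
    is bounded, \<open>S g\<close> is finite on the space, so \<open>enn2real\<close> loses nothing
    there.\<close>
  define h where "h x = g x * enn2real (S g x) powr (p - 1)" for x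
  define K1 where "K1 = 2 * 4 powr (p - 1) * (K * dyad_const 1)"
  define J where "J = (\<integral>\<^sup>+x. ennreal_rpow (S g x) p \<partial>\<nu>)"
  have K1: "0 < K1" using K dyad_const_pos[of 1] by (simp add: K1_def)
  have g: "decreasing_fun_on (space M) prec g" "\<And>x. 0 \<le> g x"
    unfolding g_def by (rule decreasing_dyad_trunc[OF f(1)], rule dyad_trunc_nonneg)
  have Sg_dec: "decreasing_fun_on (space M) prec (S g)"
    using g by (intro hardy_decreasing) auto
  have gB: "g u \<le> (\<Sum>i<n. dyad i)" for u
    unfolding g_def by (rule dyad_trunc_bounded)
  have Sg_fin: "S g x < top" if "x \<in> space M" for x
    using hardy_op_le[of x g, OF that gB] by (auto intro: le_less_trans)
  have h_dec: "decreasing_fun_on (space M) prec h"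
  proof (rule decreasing_fun_onI)
    fix x y assume xy: "x \<in> space M" "y \<in> space M" "(x, y) \<in> prec"
    show "h y \<le> h x"
      unfolding h_def using p1 g(2)
        decreasing_fun_onD[OF g(1) xy] decreasing_fun_onD[OF Sg_dec xy] Sg_fin[OF xy(1)]
      by (intro mult_mono powr_mono2 enn2real_mono) simp_all
  qed
  have h0: "0 \<le> h x" for x using g by (simp add: h_def)
  have h_eq: "ennreal (h x) = ennreal (g x) * ennreal_rpow (S g x) (p - 1)" if "x \<in> space M" for x
    using Sg_fin[OF that] g(2)[of x]
    by (cases "S g x") (auto simp: h_def ennreal_mult)
  \<comment> \<open>The pointwise power estimate for \<open>g\<close> produces the weight of
    \<open>h\<close>, whose layers are then summed. The exponent 1 is kept visible to match
    \<open>suminf_mass_bound\<close> with \<open>q = 1\<close>.\<close>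
  have "J \<le> (\<integral>\<^sup>+x. ennreal (2 * 4 powr (p - 1)) *
      (\<Sum>i. ennreal (dyad i powr 1) * ennreal_rpow (mass (level h i) x) p) \<partial>\<nu>)"
    unfolding J_def
  proof (intro nn_integral_mono)
    fix x assume "x \<in> space \<nu>"
    then have x: "x \<in> space M" by (simp add: space_nu)
    have "ennreal_rpow (S g x) p \<le> ennreal (2 * 4 powr (p - 1)) *
      (\<integral>\<^sup>+u\<in>lower_section (space M) le x. ennreal (g u) * ennreal_rpow (S g u) (p - 1)
        * ennreal_rpow (emeasure (\<mu> x) (lower_section (space M) le u)) (p - 1) \<partial>\<mu> x)"
      by (rule hardy_op_power_le[OF x prec_measurable[OF g(1)] gB p1])
    also have "\<dots> = ennreal (2 * 4 powr (p - 1)) *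
      (\<integral>\<^sup>+u\<in>lower_section (space M) le x. ennreal (h u)
        * ennreal_rpow (emeasure (\<mu> x) (lower_section (space M) le u)) (p - 1) \<partial>\<mu> x)"
      by (intro arg_cong2[where f = "(*)"] refl nn_integral_cong) (simp add: h_eq space_mu[OF x])
    also have "\<dots> \<le> ennreal (2 * 4 powr (p - 1)) *
      (\<Sum>i. ennreal (dyad i powr 1) * ennreal_rpow (mass (level h i) x) p)"
      using layered_power_le[OF x h_dec h0 p1] by (intro mult_left_mono) simp_all
    finally show "ennreal_rpow (S g x) p \<le> \<dots>" .
  qed
  also have "\<dots> = ennreal (2 * 4 powr (p - 1)) *
      (\<integral>\<^sup>+x. (\<Sum>i. ennreal (dyad i powr 1) * ennreal_rpow (mass (level h i) x) p) \<partial>\<nu>)"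
    using mass_rpow_measurable_nu[OF decreasing_set_on_level[OF h_dec]]
    by (intro nn_integral_cmult) measurable
  also have "\<dots> \<le> ennreal (2 * 4 powr (p - 1)) *
      (ennreal (K * dyad_const 1) * (\<integral>\<^sup>+x. ennreal (h x powr 1) \<partial>\<nu>))"
    by (intro mult_left_mono suminf_mass_bound h_dec h0) simp_all
  also have "\<dots> = ennreal K1 * (\<integral>\<^sup>+x. ennreal (h x) \<partial>\<nu>)"
    using K dyad_const_pos[of 1] h0 by (simp add: K1_def ennreal_mult mult.assoc)
  also have "\<dots> = (\<integral>\<^sup>+x. ennreal K1 * ennreal (h x) \<partial>\<nu>)"
    using nu_measurable[OF h_dec] by (intro nn_integral_cmult[symmetric]) measurable
  \<comment> \<open>\<open>young_absorb\<close> with \<open>a = g x\<close> and \<open>b\<close> the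
    value of \<open>S g x\<close>; afterwards \<open>g\<close> is replaced by
    \<open>dyad_const 1 * f\<close>.\<close>
  also have "\<dots> \<le> (\<integral>\<^sup>+x. ennreal (1 / 2) * ennreal_rpow (S g x) p
      + ennreal ((2 * K1 * dyad_const 1) powr p / 2) * ennreal (f x powr p) \<partial>\<nu>)"
  proof (intro nn_integral_mono)
    fix x assume "x \<in> space \<nu>"
    then have x: "x \<in> space M" by (simp add: space_nu)
    obtain b where b: "S g x = ennreal b" "0 \<le> b" using Sg_fin[OF x] by (cases "S g x") auto
    have "K1 * h x \<le> b powr p / 2 + (2 * K1) powr p * g x powr p / 2"
      using young_absorb[OF g(2) b(2) K1 p1, of x] b by (simp add: h_def)
    also have "g x powr p \<le> (dyad_const 1 * f x) powr p"
      using dyad_trunc_le[of f x n, OF f(2)[OF x]] g(2)[of x] p by (intro powr_mono2) (auto simp: g_def)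
    also have "(2 * K1) powr p * (dyad_const 1 * f x) powr p = (2 * K1 * dyad_const 1) powr p * f x powr p"
      using K1 dyad_const_pos[of 1] f(2)[OF x] by (simp add: powr_mult)
    finally have "K1 * h x \<le> 1 / 2 * b powr p + (2 * K1 * dyad_const 1) powr p / 2 * f x powr p"
      by (simp add: mult_left_mono)
    then have "ennreal (K1 * h x) \<le> ennreal (1 / 2 * b powr p + (2 * K1 * dyad_const 1) powr p / 2 * f x powr p)"
      by (rule ennreal_leI)
    then show "ennreal K1 * ennreal (h x) \<le> ennreal (1 / 2) * ennreal_rpow (S g x) p
      + ennreal ((2 * K1 * dyad_const 1) powr p / 2) * ennreal (f x powr p)"
      unfolding b(1) ennreal_rpow_ennreal[OF b(2)] using K1 h0[of x]
      by (subst ennreal_mult[symmetric], simp, simp)+ (subst ennreal_plus[symmetric], simp_all)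
  qed
  also have "\<dots> = ennreal (1 / 2) * J
      + ennreal ((2 * K1 * dyad_const 1) powr p / 2) * (\<integral>\<^sup>+x. ennreal (f x powr p) \<partial>\<nu>)"
  proof -
    have "(\<lambda>x. ennreal_rpow (S g x) p) \<in> borel_measurable \<nu>"
      using p by (intro nu_measurable decreasing_fun_on_mono_comp[OF Sg_dec] monoI ennreal_rpow_mono) auto
    moreover have "(\<lambda>x. ennreal (f x powr p)) \<in> borel_measurable \<nu>"
      using nu_measurable[OF f(1)] by measurable
    ultimately show ?thesis
      unfolding J_def by (simp add: nn_integral_add nn_integral_cmult)
  qed
  finally have J_le: "J \<le> ennreal (1 / 2) * J
      + ennreal ((2 * K1 * dyad_const 1) powr p / 2) * (\<integral>\<^sup>+x. ennreal (f x powr p) \<partial>\<nu>)" .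
  \<comment> \<open>This bound depends on \<open>n\<close> and serves only to make \<open>J\<close>
    finite, so that half of it can be subtracted from both sides.\<close>
  have "J \<le> ennreal (real n powr p * (K * dyad_const p)) * (\<integral>\<^sup>+x. ennreal (f x powr p) \<partial>\<nu>)"
    unfolding J_def g_def
    using ennreal_rpow_sum_le_card[OF p, of "{..<n}"] by (intro hardy_trunc_le_of_sum_bound f) simp_all
  also have "\<dots> < top" using fin by (simp add: ennreal_mult_less_top)
  finally obtain j where j: "J = ennreal j" "0 \<le> j" by (cases J) auto
  obtain F where F: "(\<integral>\<^sup>+x. ennreal (f x powr p) \<partial>\<nu>) = ennreal F" "0 \<le> F"
    using fin by (cases "\<integral>\<^sup>+x. ennreal (f x powr p) \<partial>\<nu>") auto
  have "ennreal j \<le> ennreal (1 / 2 * j + (2 * K1 * dyad_const 1) powr p / 2 * F)"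
    using J_le j(2) F(2) unfolding j(1) F(1)
    by (subst ennreal_plus, simp, simp, subst ennreal_mult, simp, simp, subst ennreal_mult) simp_all
  then have "j \<le> 1 / 2 * j + (2 * K1 * dyad_const 1) powr p / 2 * F"
    using j F by (subst (asm) ennreal_le_iff) simp_all
  then have "j \<le> (2 * K1 * dyad_const 1) powr p * F" by simp
  then have "ennreal j \<le> ennreal ((2 * K1 * dyad_const 1) powr p) * ennreal F"
    using F(2) by (subst ennreal_mult[symmetric]) (simp_all add: ennreal_leI)
  then show ?thesis
    using False unfolding trunc_const_def F(1) K1_def[symmetric] j(1)[symmetric] J_def g_def by simp
qed

lemma hardy_bounded:
  assumes f: "decreasing_fun_on (space M) prec f" "\<And>x. x \<in> space M \<Longrightarrow> 0 \<le> f x"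
    and fin: "(\<integral>\<^sup>+x. ennreal (f x powr p) \<partial>\<nu>) < \<infinity>"
  shows "(\<integral>\<^sup>+x. ennreal_rpow (S f x) p \<partial>\<nu>)
    \<le> ennreal trunc_const * (\<integral>\<^sup>+x. ennreal (f x powr p) \<partial>\<nu>)"
proof -
  have "(\<integral>\<^sup>+x. ennreal_rpow (S f x) p \<partial>\<nu>) \<le> (\<integral>\<^sup>+x. (SUP n. ennreal_rpow (S (dyad_trunc f n) x) p) \<partial>\<nu>)"
  proof (intro nn_integral_mono)
    fix x assume "x \<in> space \<nu>"
    then have "S f x \<le> (SUP n. S (dyad_trunc f n) x)"
      by (intro hardy_op_le_SUP f) (simp_all add: space_nu)
    then show "ennreal_rpow (S f x) p \<le> (SUP n. ennreal_rpow (S (dyad_trunc f n) x) p)"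
      using p by (subst ennreal_rpow_SUP[symmetric]) (auto intro: ennreal_rpow_mono)
  qed
  also have "\<dots> = (SUP n. \<integral>\<^sup>+x. ennreal_rpow (S (dyad_trunc f n) x) p \<partial>\<nu>)"
  \<comment> \<open>Monotonicity in \<open>n\<close> is established at points of the space only,
    hence the almost-everywhere version.\<close>
  proof (rule nn_integral_monotone_convergence_SUP_AE)
    have dec: "decreasing_fun_on (space M) prec (S (dyad_trunc f n))" for n
      by (intro hardy_decreasing decreasing_dyad_trunc f dyad_trunc_nonneg)
    show "(\<lambda>x. ennreal_rpow (S (dyad_trunc f n) x) p) \<in> borel_measurable \<nu>" for n
      using p by (intro nu_measurable decreasing_fun_on_mono_comp[OF dec] monoI ennreal_rpow_mono) auto
    have "dyad_trunc f n x \<le> dyad_trunc f (Suc n) x" for n x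
      by (simp add: dyad_trunc_def)
    then show "AE x in \<nu>. ennreal_rpow (S (dyad_trunc f n) x) p \<le> ennreal_rpow (S (dyad_trunc f (Suc n)) x) p" for n
      using p by (intro AE_I2 ennreal_rpow_mono hardy_op_mono) (simp_all add: space_nu)
  qed
  also have "\<dots> \<le> ennreal trunc_const * (\<integral>\<^sup>+x. ennreal (f x powr p) \<partial>\<nu>)"
    by (intro SUP_least hardy_trunc_bounded f fin)
  finally show ?thesis .
qed

lemma trunc_const_nonneg: "0 \<le> trunc_const"
  using K dyad_const_pos[OF p] by (simp add: trunc_const_def)

end

section \<open>The test condition over the whole space, and the equivalence\<close>

lemma mass_eq_1:
  assumes "decreasing_set_on (space M) prec D" "x \<in> D"
  shows "mass D x = 1"
proof -
  have x: "x \<in> space M" using assms by (auto simp: decreasing_set_on_iff)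
  have "lower_section (space M) le x \<subseteq> D"
    using assms x by (auto simp: decreasing_set_on_iff lower_section_def intro: le_imp_prec)
  then show ?thesis using section_mass[OF x] by (simp add: Int_absorb1)
qed

text \<open>The mass is one on \<open>D\<close>, so this part contributes exactly the measure of
  \<open>D\<close>. A test constant \<open>C\<close> thus becomes the constant \<open>1 + C\<close>
  for the integral over the whole space.\<close>

lemma nn_integral_mass_split:
  assumes D: "decreasing_set_on (space M) prec D" and nu: "sets \<nu> = sets M" and p: "0 < p"
  shows "(\<integral>\<^sup>+x. ennreal_rpow (mass D x) p \<partial>\<nu>)
    = emeasure \<nu> D + (\<integral>\<^sup>+x\<in>space M - D. ennreal_rpow (mass D x) p \<partial>\<nu>)"
proof -
  have sp: "space \<nu> = space M" using nu by (rule sets_eq_imp_space_eq)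
  have Dm: "D \<in> sets \<nu>" using prec_decreasing_set[OF D] nu by simp
  have m: "(\<lambda>x. ennreal_rpow (mass D x) p) \<in> borel_measurable \<nu>"
    using mass_rpow_measurable[OF D, of p] p by (simp add: measurable_cong_sets[OF nu refl])
  have "(\<integral>\<^sup>+x. ennreal_rpow (mass D x) p \<partial>\<nu>)
      = (\<integral>\<^sup>+x. indicator D x + ennreal_rpow (mass D x) p * indicator (space M - D) x \<partial>\<nu>)"
    using mass_eq_1[OF D] by (intro nn_integral_cong) (auto simp: sp split: split_indicator)
  also have "\<dots> = emeasure \<nu> D + (\<integral>\<^sup>+x\<in>space M - D. ennreal_rpow (mass D x) p \<partial>\<nu>)"
    using Dm m sets.compl_sets[OF Dm] sp by (subst nn_integral_add) auto
  finally show ?thesis .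
qed

end

theorem theorem2p2:
  fixes M \<nu> :: "'a measure" and \<mu> :: "'a \<Rightarrow> 'a measure" and le prec :: "'a rel" and p :: real
  assumes "ordered_measure_family M \<mu> le"
    and "second_order M \<mu> le prec"
    and "sets \<nu> = sets M"
    and "0 < p"
  shows "(\<exists>C'\<ge>0. \<forall>f\<in>Lp_decreasing \<nu> prec p.
            Lp_norm \<nu> p (hardy_op (space M) \<mu> le f)
              \<le> ennreal C' * Lp_norm \<nu> p (\<lambda>x. ennreal (f x)))
     \<longleftrightarrow>
         (\<exists>C>0. \<forall>D. decreasing_set_on (space M) prec D \<longrightarrow>
            (\<integral>\<^sup>+x\<in>space M - D. ennreal_rpow (emeasure (\<mu> x) (D \<inter> lower_section (space M) le x)) p \<partial>\<nu>)
              \<le> ennreal C * emeasure \<nu> D)"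
    (is "?bounded \<longleftrightarrow> ?test")
proof -
  interpret second_order M \<mu> le prec by fact
  note nu = assms(3) and p = assms(4)
  have sp: "space \<nu> = space M" using nu by (rule sets_eq_imp_space_eq)
  show ?thesis
  proof
    assume ?bounded
    then obtain C' where C': "0 \<le> C'"
      and bd: "\<And>f. f \<in> Lp_decreasing \<nu> prec p \<Longrightarrow> Lp_norm \<nu> p (S f) \<le> ennreal C' * Lp_norm \<nu> p (\<lambda>x. ennreal (f x))"
      by blast
    \<comment> \<open>Testing on the indicator of \<open>D\<close> gives the constant
      \<open>C' powr p\<close>; adding 1 keeps it positive when \<open>C' = 0\<close>.\<close>
    have "(\<integral>\<^sup>+x\<in>space M - D. ennreal_rpow (mass D x) p \<partial>\<nu>) \<le> ennreal (C' powr p + 1) * emeasure \<nu> D"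
      if D: "decreasing_set_on (space M) prec D" for D
    \<comment> \<open>If \<open>D\<close> has infinite measure its indicator is not an admissible
      test function, but then the right-hand side is infinite, as the constant is positive.\<close>
    proof (cases "emeasure \<nu> D = top")
      case True
      have "0 < C' powr p + 1" by (simp add: add_nonneg_pos)
      with True show ?thesis by (simp add: ennreal_mult_top)
    next
      case False
      have Dm: "D \<in> sets M" "D \<in> sets \<nu>" using prec_decreasing_set[OF D] nu by auto
      have "(\<integral>\<^sup>+x. ennreal_rpow (ennreal (indicator D x)) p \<partial>\<nu>) = (\<integral>\<^sup>+x. indicator D x \<partial>\<nu>)"
        by (intro nn_integral_cong) (simp split: split_indicator)
      then have norm: "Lp_norm \<nu> p (\<lambda>x. ennreal (indicator D x)) = ennreal_rpow (emeasure \<nu> D) (1 / p)"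
        using Dm by (simp add: Lp_norm_def)
      have "indicator D \<in> Lp_decreasing \<nu> prec p"
        unfolding Lp_decreasing_def
        using D Dm False norm by (cases "emeasure \<nu> D") (auto simp: sp decreasing_set_on_def)
      from bd[OF this] have
        "ennreal_rpow (\<integral>\<^sup>+x. ennreal_rpow (S (indicator D) x) p \<partial>\<nu>) (1 / p)
          \<le> ennreal C' * ennreal_rpow (emeasure \<nu> D) (1 / p)"
        unfolding norm by (simp add: Lp_norm_def)
      also have "\<dots> = ennreal_rpow (ennreal (C' powr p) * emeasure \<nu> D) (1 / p)"
        using p C' by (simp add: ennreal_rpow_mult powr_powr)
      finally have "(\<integral>\<^sup>+x. ennreal_rpow (S (indicator D) x) p \<partial>\<nu>) \<le> ennreal (C' powr p) * emeasure \<nu> D"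
        using p by (elim ennreal_rpow_le_cancel[rotated]) simp
      also have "(\<integral>\<^sup>+x. ennreal_rpow (S (indicator D) x) p \<partial>\<nu>) = (\<integral>\<^sup>+x. ennreal_rpow (mass D x) p \<partial>\<nu>)"
        using Dm by (intro nn_integral_cong) (simp add: sp hardy_op_indicator)
      finally have "(\<integral>\<^sup>+x\<in>space M - D. ennreal_rpow (mass D x) p \<partial>\<nu>) \<le> ennreal (C' powr p) * emeasure \<nu> D"
        unfolding nn_integral_mass_split[OF D nu p] by (rule order_trans[rotated]) simp
      also have "\<dots> \<le> ennreal (C' powr p + 1) * emeasure \<nu> D"
        by (intro mult_right_mono ennreal_leI) auto
      finally show ?thesis .
    qed
    moreover have "0 < C' powr p + 1" by (simp add: add_nonneg_pos)
    ultimately show ?test by blast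
  next
    assume ?test
    then obtain C where C: "0 < C"
      and test: "\<And>D. decreasing_set_on (space M) prec D \<Longrightarrow>
        (\<integral>\<^sup>+x\<in>space M - D. ennreal_rpow (mass D x) p \<partial>\<nu>) \<le> ennreal C * emeasure \<nu> D"
      by blast
    have mass_bd: "(\<integral>\<^sup>+x. ennreal_rpow (mass D x) p \<partial>\<nu>) \<le> ennreal (1 + C) * emeasure \<nu> D"
      if "decreasing_set_on (space M) prec D" for D
      using add_left_mono[OF test[OF that], of "emeasure \<nu> D"] C
      unfolding nn_integral_mass_split[OF that nu p] by (simp add: distrib_right)
    have K: "0 < 1 + C" using C by simp
    \<comment> \<open>\<open>B\<close> controls integrals of \<open>p\<close>-th powers, so the
      operator bound is its \<open>p\<close>-th root.\<close>
    define B where "B = trunc_const p (1 + C)"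
    have B: "0 \<le> B" unfolding B_def by (rule trunc_const_nonneg[OF nu p K mass_bd])
    have "Lp_norm \<nu> p (S f) \<le> ennreal (B powr (1 / p)) * Lp_norm \<nu> p (\<lambda>x. ennreal (f x))"
      if "f \<in> Lp_decreasing \<nu> prec p" for f
    proof -
      have f: "decreasing_fun_on (space M) prec f" "\<And>x. x \<in> space M \<Longrightarrow> 0 \<le> f x"
        and fin: "Lp_norm \<nu> p (\<lambda>x. ennreal (f x)) < \<infinity>"
        using that by (auto simp: Lp_decreasing_def sp)
      have eq: "(\<integral>\<^sup>+x. ennreal_rpow (ennreal (f x)) p \<partial>\<nu>) = (\<integral>\<^sup>+x. ennreal (f x powr p) \<partial>\<nu>)"
        using f(2) by (intro nn_integral_cong) (simp add: sp)
      have "(\<integral>\<^sup>+x. ennreal (f x powr p) \<partial>\<nu>) < \<infinity>"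
        using fin unfolding Lp_norm_def eq
        by (cases "(\<integral>\<^sup>+x. ennreal (f x powr p) \<partial>\<nu>)") auto
      then have "(\<integral>\<^sup>+x. ennreal_rpow (S f x) p \<partial>\<nu>) \<le> ennreal B * (\<integral>\<^sup>+x. ennreal (f x powr p) \<partial>\<nu>)"
        unfolding B_def by (intro hardy_bounded[OF nu p K mass_bd] f)
      then have "Lp_norm \<nu> p (S f) \<le> ennreal_rpow (ennreal B * (\<integral>\<^sup>+x. ennreal (f x powr p) \<partial>\<nu>)) (1 / p)"
        unfolding Lp_norm_def using p by (intro ennreal_rpow_mono) auto
      then show ?thesis
        using p B by (simp add: Lp_norm_def eq ennreal_rpow_mult)
    qed
    then show ?bounded by (intro exI[of _ "B powr (1 / p)"]) simp
  qed
qed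

end
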